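(* Let $\{S_{\mathbf a^{[k]}},\ k\ge0\}$ be a $\Phi_N$-generating non-stationary subdivision scheme which reproduces at least one exponential polynomial in $\Phi_N$, where the Wronskian matrix $\mathcal W_{\Phi_N}(x)$ is invertible for all $x$ in a neighborhood of zero. If $\{S_{\mathbf a^{[k]}},\ k\ge0\}$ is asymptotically similar to a convergent stationary scheme, then it satisfies approximate sum rules of order $N$.
   Context: Subdivision schemes. For each $k\ge 0$ let $\mathbf a^{[k]}=\{a^{[k]}_i\in\mathbb R,\ i\in\mathbb Z\}$ be a mask; all masks are supported in $\{-M,\dots,M\}$ for one fixed $M\in\mathbb N$. The subdivision operator is $(S_{\mathbf a^{[k]}}\mathbf f)_i=\sum_{j\in\mathbb Z}a^{[k]}_{i-2j}f_j$, $i\in\mathbb Z$. The (non-stationary) subdivision scheme $\{S_{\mathbf a^{[k]}},k\ge0\}$ produces from initial data $\mathbf f^{[0]}$ the sequences $\mathbf f^{[k]}=S_{\mathbf a^{[k-1]}}\cdots S_{\mathbf a^{[0]}}\mathbf f^{[0]}$. It is stationary, written $\{S_{\mathbf a}\}$, if all operators coincide. The symbols are $a^{[k]}(z)=\sum_i a_i^{[k]}z^i$, $z\in\mathbb C\setminus\{0\}$. The scheme is convergent if for every $\mathbf f^{[0]}\in\ell_\infty(\mathbb Z)$ there is a continuous function $g$ on $\mathbb R$ with $\lim_{k\to\infty}\sup_{i}|g(i2^{-k})-(\mathbf f^{[k]})_i|=0$; $g$ is the limit from $\mathbf f^{[0]}$. For unbounded data the limit is understood locally, which makes sense because the masks are finitely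 supported. Exponential polynomials. Let $\eta,N\in\mathbb N$, $\lambda_1,\dots,\lambda_\eta\in\mathbb C$, and $\mu_1,\dots,\mu_\eta\in\mathbb N$ with $\sum_n\mu_n=N$. $\Phi_N=\mathrm{span}\{x^\beta e^{\lambda_n x}:\beta=0,\dots,\mu_n-1,\ n=1,\dots,\eta\}$, spanned by $N$ linearly independent functions; these are listed as $\varphi_0,\dots,\varphi_{N-1}$. Parametrization. Level-$k$ data are attached to the grid points $t_i^{[k]}=(i+p)/2^k$, with shift parameter $p\in\{0,-\frac12\}$ (primal if $p=0$, dual if $p=-\frac12$). Generation. A convergent scheme is $\Phi_N$-generating if for every $f\in\Phi_N$ the limit from the initial data $\{f(t_i^{[0]}),i\in\mathbb Z\}$ belongs to $\Phi_N$; moreover, its symbols satisfy $a^{[k]}(z)=b^{[k]}(z)\prod_{n=1}^\eta(1+e^{\lambda_n2^{-k-1}}z)^{\mu_n}$ for all $k\ge0$ and some Laurent polynomials $b^{[k]}$. Reproduction of (at least) one exponential polynomial in $\Phi_N$. For some $n$ and some $0\le r\le\mu_n-1$, with $f(x)=x^re^{\lambda_nx}$, the limit from the data $\{f(t^{[0]}_i),i\in\mathbb Z\}$ equals $f$. As the paper observes, then $e^{\lambda x}$ with $\lambda=\lambda_n$ is reproduced as well, and this means on the symbols: $a^{[k]}(-r_k^{-1})=0$ and $a^{[k]}(r_k^{-1})=2r_k^{-p}$ for all $k\ge0$, where $r_k=e^{\lambda2^{-k-1}}$. Asymptotical similarity of $\{S_{\mathbf a^{[k]}},k\ge0\}$ to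 $\{S_{\mathbf a}\}$: $\lim_{k\to\infty}\|\mathbf a^{[k]}-\mathbf a\|=0$, with $\|\cdot\|$ the supremum norm of sequences; $\mathbf a$ is also supported in $\{-M,\dots,M\}$. Wronskian matrix: $\mathcal W_{\Phi_N}(x)=\left(\frac1{\beta!}\frac{d^\beta\varphi_\alpha(x)}{dx^\beta}\right)_{\alpha,\beta=0,\dots,N-1}$. Approximate sum rules of order $N$: $\sum_{k=0}^\infty|a^{[k]}(1)-2|<\infty$ and $\sum_{k=0}^\infty2^{k(N-1)}\sigma_k<\infty$, where $\sigma_k=\max_{\beta=0,\dots,N-1}2^{-k\beta}\left|\frac{d^\beta a^{[k]}(-1)}{dz^\beta}\right|$. *)

theory Defs
  imports "HOL-Analysis.Analysis" "Jordan_Normal_Form.Matrix"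
begin

section \<open>Masks, symbols and subdivision operators\<close>

definition mask_within :: "nat \<Rightarrow> (int \<Rightarrow> real) \<Rightarrow> bool" where
  "mask_within M a \<longleftrightarrow> (\<forall>i. a i \<noteq> 0 \<longrightarrow> i \<in> {- int M..int M})"

text \<open>Meant for finitely supported coefficients and \<open>z \<noteq> 0\<close>.\<close>
definition laurent_eval :: "(int \<Rightarrow> complex) \<Rightarrow> complex \<Rightarrow> complex" where
  "laurent_eval b z = (\<Sum>i | b i \<noteq> 0. b i * z powi i)"

definition mask_symbol :: "(int \<Rightarrow> real) \<Rightarrow> complex \<Rightarrow> complex" where
  "mask_symbol a = laurent_eval (\<lambda>i. complex_of_real (a i))"

text \<open>Data are complex-valued, because exponential polynomials are. For a finitely
  supported mask, only finitely many terms are non-zero.\<close>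
definition subdiv :: "(int \<Rightarrow> real) \<Rightarrow> (int \<Rightarrow> complex) \<Rightarrow> int \<Rightarrow> complex" where
  "subdiv a f i = (\<Sum>j | a (i - 2 * j) \<noteq> 0. complex_of_real (a (i - 2 * j)) * f j)"

primrec subdiv_data ::
  "(nat \<Rightarrow> int \<Rightarrow> real) \<Rightarrow> (int \<Rightarrow> complex) \<Rightarrow> nat \<Rightarrow> int \<Rightarrow> complex" where
  "subdiv_data A f 0 = f"
| "subdiv_data A f (Suc k) = subdiv (A k) (subdiv_data A f k)"


section \<open>Convergence and limits\<close>

text \<open>The supremum over all \<open>i\<close> of the error at level \<open>k\<close> tends to \<open>0\<close>; it is expressed by
  \<^const>\<open>uniform_limit\<close>, since a real supremum of an unbounded set is unspecified.\<close>
definition convergent_scheme :: "(nat \<Rightarrow> int \<Rightarrow> real) \<Rightarrow> bool" where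
  "convergent_scheme A \<longleftrightarrow>
     (\<forall>f. bounded (range f) \<longrightarrow>
        (\<exists>g :: real \<Rightarrow> complex. continuous_on UNIV g \<and>
           uniform_limit UNIV (\<lambda>k i. g (of_int i / 2 ^ k) - subdiv_data A f k i) (\<lambda>_. 0)
             sequentially))"

text \<open>The limit from possibly unbounded data: uniform on compact sets.\<close>
definition scheme_limit ::
  "(nat \<Rightarrow> int \<Rightarrow> real) \<Rightarrow> (int \<Rightarrow> complex) \<Rightarrow> (real \<Rightarrow> complex) \<Rightarrow> bool" where
  "scheme_limit A f g \<longleftrightarrow>
     continuous_on UNIV g \<and>
     (\<forall>K :: real set. compact K \<longrightarrow> (\<forall>e>0. \<forall>\<^sub>F k in sequentially. \<forall>i.
        real_of_int i / 2 ^ k \<in> K \<longrightarrow> cmod (g (of_int i / 2 ^ k) - subdiv_data A f k i) < e))"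

definition asymptotically_similar ::
  "(nat \<Rightarrow> int \<Rightarrow> real) \<Rightarrow> (int \<Rightarrow> real) \<Rightarrow> bool" where
  "asymptotically_similar A a \<longleftrightarrow> (\<lambda>k. SUP i. \<bar>A k i - a i\<bar>) \<longlonglongrightarrow> 0"


section \<open>Exponential polynomials\<close>

definition exp_monomial :: "nat \<Rightarrow> complex \<Rightarrow> real \<Rightarrow> complex" where
  "exp_monomial \<beta> l x = of_real x ^ \<beta> * exp (l * of_real x)"

definition exp_monomials ::
  "nat \<Rightarrow> (nat \<Rightarrow> complex) \<Rightarrow> (nat \<Rightarrow> nat) \<Rightarrow> (real \<Rightarrow> complex) set" where
  "exp_monomials \<eta> lam mu = {exp_monomial \<beta> (lam n) | \<beta> n. n < \<eta> \<and> \<beta> < mu n}"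

text \<open>The complex linear span of the finite set of exponential monomials.\<close>
definition exp_poly_space ::
  "nat \<Rightarrow> (nat \<Rightarrow> complex) \<Rightarrow> (nat \<Rightarrow> nat) \<Rightarrow> (real \<Rightarrow> complex) set" where
  "exp_poly_space \<eta> lam mu = {f. \<exists>c. f = (\<lambda>x. \<Sum>g\<in>exp_monomials \<eta> lam mu. c g * g x)}"

definition lin_indep_funs :: "nat \<Rightarrow> (nat \<Rightarrow> real \<Rightarrow> complex) \<Rightarrow> bool" where
  "lin_indep_funs N \<phi> \<longleftrightarrow>
     (\<forall>c :: nat \<Rightarrow> complex. (\<forall>x. (\<Sum>\<alpha><N. c \<alpha> * \<phi> \<alpha> x) = 0) \<longrightarrow> (\<forall>\<alpha><N. c \<alpha> = 0))"

definition wronskian_mat ::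
  "nat \<Rightarrow> (nat \<Rightarrow> real \<Rightarrow> complex) \<Rightarrow> real \<Rightarrow> complex Matrix.mat" where
  "wronskian_mat N \<phi> x =
     Matrix.mat N N (\<lambda>(\<alpha>, \<beta>).
       1 / fact \<beta> * ((\<lambda>h t. vector_derivative h (at t)) ^^ \<beta>) (\<phi> \<alpha>) x)"


section \<open>Generation and reproduction\<close>

text \<open>The grid points \<open>(i + p) / 2 ^ k\<close> with shift parameter \<open>p\<close>.\<close>
definition grid_point :: "real \<Rightarrow> nat \<Rightarrow> int \<Rightarrow> real" where
  "grid_point p k i = (of_int i + p) / 2 ^ k"

definition sample_data :: "real \<Rightarrow> (real \<Rightarrow> complex) \<Rightarrow> int \<Rightarrow> complex" where
  "sample_data p f i = f (grid_point p 0 i)"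

text \<open>Generation comprises both the requirement on limits and the factorization of the
  symbols: without a non-singularity assumption on the scheme, the former alone does not
  give the latter.\<close>
definition generating ::
  "real \<Rightarrow> nat \<Rightarrow> (nat \<Rightarrow> complex) \<Rightarrow> (nat \<Rightarrow> nat) \<Rightarrow> (nat \<Rightarrow> int \<Rightarrow> real) \<Rightarrow> bool" where
  "generating p \<eta> lam mu A \<longleftrightarrow>
     convergent_scheme A \<and>
     (\<forall>f \<in> exp_poly_space \<eta> lam mu. \<exists>g \<in> exp_poly_space \<eta> lam mu.
        scheme_limit A (sample_data p f) g) \<and>
     (\<forall>k. \<exists>b. finite {i. b i \<noteq> 0} \<and>
        (\<forall>z. z \<noteq> 0 \<longrightarrow>
           mask_symbol (A k) z =
             laurent_eval b z * (\<Prod>n<\<eta>. (1 + exp (lam n / 2 ^ (k + 1)) * z) ^ mu n)))"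

text \<open>With \<open>r = exp (l / 2 ^ (k + 1))\<close>, the conditions are that the symbol vanishes at
  \<open>- 1 / r\<close> and has value \<open>2 * r powr (- p)\<close> at \<open>1 / r\<close>. The power of \<open>r\<close> is written as an
  exponential, because \<open>powr\<close> would use the principal logarithm of \<open>r\<close>, which
  may differ from \<open>l / 2 ^ (k + 1)\<close>.\<close>
definition symbols_reproduce_exp ::
  "real \<Rightarrow> complex \<Rightarrow> (nat \<Rightarrow> int \<Rightarrow> real) \<Rightarrow> bool" where
  "symbols_reproduce_exp p l A \<longleftrightarrow>
     (\<forall>k. mask_symbol (A k) (- inverse (exp (l / 2 ^ (k + 1)))) = 0 \<and>
          mask_symbol (A k) (inverse (exp (l / 2 ^ (k + 1)))) =
            2 * exp (- of_real p * (l / 2 ^ (k + 1))))"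

text \<open>Reproduction comprises both the requirement on the limit and the conditions on all the
  symbols: the limit from level-0 data alone does not determine the individual symbols
  (rescaling the masks by factors with product \<open>1\<close> preserves it).\<close>
definition reproduces_some ::
  "real \<Rightarrow> nat \<Rightarrow> (nat \<Rightarrow> complex) \<Rightarrow> (nat \<Rightarrow> nat) \<Rightarrow> (nat \<Rightarrow> int \<Rightarrow> real) \<Rightarrow> bool" where
  "reproduces_some p \<eta> lam mu A \<longleftrightarrow>
     (\<exists>n<\<eta>. \<exists>r<mu n.
        scheme_limit A (sample_data p (exp_monomial r (lam n))) (exp_monomial r (lam n)) \<and>
        symbols_reproduce_exp p (lam n) A)"


section \<open>Approximate sum rules\<close>

definition sum_rule_defect :: "nat \<Rightarrow> (nat \<Rightarrow> int \<Rightarrow> real) \<Rightarrow> nat \<Rightarrow> real" where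
  "sum_rule_defect N A k =
     Max ((\<lambda>\<beta>. 1 / 2 ^ (k * \<beta>) * cmod ((deriv ^^ \<beta>) (mask_symbol (A k)) (- 1))) ` {..<N})"

text \<open>Meant for \<open>N > 0\<close>, so that the maximum is over a non-empty set.\<close>
definition approximate_sum_rules :: "nat \<Rightarrow> (nat \<Rightarrow> int \<Rightarrow> real) \<Rightarrow> bool" where
  "approximate_sum_rules N A \<longleftrightarrow>
     summable (\<lambda>k. cmod (mask_symbol (A k) 1 - 2)) \<and>
     summable (\<lambda>k. 2 ^ (k * (N - 1)) * sum_rule_defect N A k)"

end

theory Submission
  imports Defs "HOL-Complex_Analysis.Complex_Analysis"
begin

text \<open>
  Both sums converge because their terms decay like \<open>2\<^sup>-\<^sup>k\<close>. Asymptotical similarity provides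
  a bound on the mask coefficients that is uniform in the level \<open>k\<close>. As the supports lie in a fixed
  interval, the symbols are then uniformly bounded on the disc of radius \<open>1/2\<close> around \<open>-1\<close>
  (lemmas \<open>asymptotically_similar_bounded\<close> and \<open>norm_mask_symbol_le\<close>).

  Near \<open>1\<close>: reproduction of \<open>e\<^sup>\<lambda>\<^sup>x\<close> prescribes the value of the symbol at a point whose distance
  to \<open>1\<close> is of order \<open>2\<^sup>-\<^sup>k\<close>, and that value is itself within order \<open>2\<^sup>-\<^sup>k\<close> of \<open>2\<close>. The Laurent
  monomials of the symbol change by order \<open>2\<^sup>-\<^sup>k\<close> between that point and \<open>1\<close>
  (lemma \<open>summable_symbol_at_one\<close>).

  Near \<open>-1\<close>: write the symbol as \<open>b P\<close> with \<open>P\<close> the product of the \<open>N\<close> generation factors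
  \<open>1 + r z\<close>, where \<open>r = 1 + O(2\<^sup>-\<^sup>k)\<close>. On the circle \<open>\<bar>z + 1\<bar> = 1/2\<close> all factors stay away from \<open>0\<close>, so
  \<open>b\<close> is bounded there uniformly in \<open>k\<close>, and by the maximum modulus principle also inside. At
  distance \<open>2\<^sup>-\<^sup>k\<close> from \<open>-1\<close> each of the \<open>N\<close> factors is of order \<open>2\<^sup>-\<^sup>k\<close>, so the symbol is of order
  \<open>2\<^sup>-\<^sup>k\<^sup>N\<close> (lemma \<open>norm_factored_symbol_le\<close>). Cauchy's inequality on the circle of radius \<open>2\<^sup>-\<^sup>k\<close> costs
  exactly the factor \<open>2\<^sup>k\<^sup>\<beta>\<close> for the derivative of order \<open>\<beta>\<close>, which the weights in the sum rule
  defect compensate (lemma \<open>sum_rule_defect_le\<close>). Hence the defect is of order \<open>2\<^sup>-\<^sup>k\<^sup>N\<close>, which leaves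
  \<open>2\<^sup>-\<^sup>k\<close> after multiplication by \<open>2 ^ (k * (N - 1))\<close>.
\<close>

section \<open>The exponential function near zero\<close>

lemma norm_exp_minus_one_le:
  fixes w :: complex
  assumes "norm w \<le> 1"
  shows "norm (exp w - 1) \<le> 3 * norm w"
proof -
  have "norm (exp w - exp 0) \<le> 3 * norm (w - 0)"
  proof (rule field_differentiable_bound[where S = "cball 0 1" and f' = exp])
    show "norm (exp z) \<le> 3" if "z \<in> cball 0 1" for z :: complex
    proof -
      have "norm (exp z) \<le> exp (norm z)"
        by (rule norm_exp)
      also have "\<dots> \<le> exp 1"
        using that by simp
      also have "\<dots> \<le> 3"
        by (rule exp_le)
      finally show ?thesis .
    qed
  qed (use assms in \<open>auto intro!: DERIV_subset[OF DERIV_exp]\<close>)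
  then show ?thesis
    by simp
qed

lemma eventually_le_power2:
  fixes c :: real
  shows "\<forall>\<^sub>F k :: nat in sequentially. c \<le> 2 ^ k"
proof -
  obtain n where n: "c < 2 ^ n"
    using real_arch_pow[of 2 c] by auto
  have "c \<le> 2 ^ k" if "n \<le> k" for k
    using that by (intro order_trans[OF less_imp_le[OF n] power_increasing]) auto
  then show ?thesis
    unfolding eventually_sequentially by blast
qed

lemma exp_div_power2_minus_one_bigo:
  fixes w :: complex
  shows "(\<lambda>k. exp (w / 2 ^ k) - 1) \<in> O(\<lambda>k. 1 / 2 ^ k)"
proof (rule bigoI)
  show "\<forall>\<^sub>F k in sequentially. norm (exp (w / 2 ^ k) - 1) \<le> (3 * norm w) * norm (1 / 2 ^ k :: complex)"
    using eventually_le_power2[of "norm w"]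
  proof eventually_elim
    case (elim k)
    then have "norm (w / 2 ^ k) \<le> 1"
      by (simp add: norm_divide norm_power)
    from norm_exp_minus_one_le[OF this] show ?case
      by (simp add: norm_divide norm_power)
  qed
qed

section \<open>Uniform bounds for the symbols\<close>

lemma mask_symbol_eq_sum:
  assumes "mask_within M a"
  shows "mask_symbol a z = (\<Sum>i\<in>{- int M..int M}. of_real (a i) * z powi i)"
  unfolding mask_symbol_def laurent_eval_def
  using assms by (intro sum.mono_neutral_left) (auto simp: mask_within_def)

text \<open>A convergent real sequence is bounded, so the masks stay within a bounded distance of the
  limit mask, which has only finitely many non-zero coefficients.\<close>
lemma asymptotically_similar_bounded:
  assumes "\<And>k. mask_within M (A k)" and "mask_within M a" and "asymptotically_similar A a"
  obtains C where "\<And>k i. \<bar>A k i\<bar> \<le> C" and "0 \<le> C"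
proof -
  have vanish: "A k i = 0" "a i = 0" if "i \<notin> {- int M..int M}" for k i
    using assms(1)[of k] assms(2) that by (auto simp: mask_within_def)
  \<comment> \<open>Finiteness of the range makes the supremum in the definition an actual upper bound.\<close>
  have bdd: "bdd_above (range (\<lambda>i. \<bar>A k i - a i\<bar>))" for k
  proof -
    have "range (\<lambda>i. \<bar>A k i - a i\<bar>) \<subseteq> insert 0 ((\<lambda>i. \<bar>A k i - a i\<bar>) ` {- int M..int M})"
      using vanish by force
    then have "finite (range (\<lambda>i. \<bar>A k i - a i\<bar>))"
      by (rule finite_subset) simp
    then show ?thesis
      by (rule bdd_above.I2[OF Max_ge]) auto
  qed
  have "Bseq (\<lambda>k. SUP i. \<bar>A k i - a i\<bar>)"
    using assms(3) convergentI convergent_imp_Bseq unfolding asymptotically_similar_def by blast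
  then obtain K where K: "\<And>k. \<bar>SUP i. \<bar>A k i - a i\<bar>\<bar> \<le> K"
    by (auto simp: Bseq_def)
  define B where "B = (\<Sum>i\<in>{- int M..int M}. \<bar>a i\<bar>)"
  have "\<bar>a i\<bar> \<le> B" for i
  proof (cases "i \<in> {- int M..int M}")
    case True
    then show ?thesis
      unfolding B_def by (intro member_le_sum) auto
  next
    case False
    then show ?thesis
      using vanish by (simp add: B_def sum_nonneg)
  qed
  then have le: "\<bar>A k i\<bar> \<le> K + B" for k i
    using cSUP_upper[OF UNIV_I bdd[of k], of i] K[of k] abs_triangle_ineq2[of "A k i" "a i"]
      abs_ge_self[of "SUP i. \<bar>A k i - a i\<bar>"] by (meson add_mono diff_le_eq order_trans)
  with that[of "K + B"] show thesis
    using abs_ge_zero order_trans by blast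
qed

text \<open>The disc keeps a distance of \<open>1/2\<close> from the pole at \<open>0\<close>: there \<open>\<bar>z\<bar>\<close> and \<open>1/\<bar>z\<bar>\<close> are at
  most \<open>2\<close>, which bounds each of the \<open>2M + 1\<close> monomials.\<close>
lemma norm_mask_symbol_le:
  assumes "mask_within M a" and "\<And>i. \<bar>a i\<bar> \<le> C" and "z \<in> cball (- 1) (1 / 2)"
  shows "norm (mask_symbol a z) \<le> real (2 * M + 1) * (C * 2 ^ M)"
proof -
  have "norm z \<le> norm (z + 1) + norm (1 :: complex)" "norm (1 :: complex) \<le> norm (z + 1) + norm z"
    by norm+
  moreover have "norm (z + 1) \<le> 1 / 2"
    using assms(3) by (simp add: dist_norm norm_minus_commute)
  ultimately have z: "norm z \<le> 2" "1 / 2 \<le> norm z"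
    by auto
  have pow: "norm (z powi i) \<le> 2 ^ M" if i: "i \<in> {- int M..int M}" for i
  proof (cases "i \<ge> 0")
    case True
    then have "norm (z powi i) = norm z ^ nat i"
      by (simp add: norm_power_int norm_power norm_inverse power_int_def)
    also have "\<dots> \<le> 2 ^ nat i"
      using z by (intro power_mono) auto
    also have "\<dots> \<le> 2 ^ M"
      using i by (intro power_increasing) auto
    finally show ?thesis .
  next
    case False
    then have "norm (z powi i) = inverse (norm z) ^ nat (- i)"
      by (simp add: norm_power_int norm_power norm_inverse power_int_def)
    also have "\<dots> \<le> 2 ^ nat (- i)"
      using z le_imp_inverse_le[of "1 / 2" "norm z"] by (intro power_mono) auto
    also have "\<dots> \<le> 2 ^ M"
      using i by (intro power_increasing) auto
    finally show ?thesis .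
  qed
  have "norm (mask_symbol a z) \<le> (\<Sum>i\<in>{- int M..int M}. C * 2 ^ M)"
    unfolding mask_symbol_eq_sum[OF assms(1)]
  proof (rule sum_norm_le)
    fix i assume "i \<in> {- int M..int M}"
    then have "\<bar>a i\<bar> * norm (z powi i) \<le> C * 2 ^ M"
      using pow assms(2) order_trans[OF abs_ge_zero assms(2)] by (intro mult_mono) auto
    then show "norm (of_real (a i) * z powi i) \<le> C * 2 ^ M"
      by (simp add: norm_mult)
  qed
  also have "\<dots> = real (2 * M + 1) * (C * 2 ^ M)"
    by simp
  finally show ?thesis .
qed

lemma laurent_eval_holomorphic_on:
  assumes "0 \<notin> S"
  shows "laurent_eval b holomorphic_on S"
  unfolding laurent_eval_def using assms by (auto intro!: holomorphic_intros)

lemma mask_symbol_holomorphic_on: "0 \<notin> S \<Longrightarrow> mask_symbol a holomorphic_on S"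
  unfolding mask_symbol_def by (rule laurent_eval_holomorphic_on)

section \<open>The value of the symbols at one\<close>

text \<open>Expanding the reproduction condition at \<open>1/r = e\<^sup>-\<^sup>h\<close>, where \<open>h\<close> is of order \<open>2\<^sup>-\<^sup>k\<close>, and subtracting
  the symbol at \<open>1\<close> leaves a fixed number of differences \<open>e\<^sup>w - 1\<close> with \<open>w\<close> a constant multiple
  of \<open>h\<close>, weighted by bounded coefficients.\<close>
lemma summable_symbol_at_one:
  assumes within: "\<And>k. mask_within M (A k)"
    and bound: "\<And>k i. \<bar>A k i\<bar> \<le> C"
    and repr: "symbols_reproduce_exp p l A"
  shows "summable (\<lambda>k. norm (mask_symbol (A k) 1 - 2))"
proof -
  define E where "E w k = exp (w / 2 ^ k) - 1" for w :: complex and k :: nat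
  have E: "(\<lambda>k. E w k) \<in> O(\<lambda>k. 1 / 2 ^ k)" for w
    unfolding E_def by (rule exp_div_power2_minus_one_bigo)
  have eq: "mask_symbol (A k) 1 - 2 =
      2 * E (- of_real p * l / 2) k - (\<Sum>i\<in>{- int M..int M}. of_real (A k i) * E (- of_int i * l / 2) k)" for k
  proof -
    have powi: "inverse (exp (l / 2 ^ (k + 1))) powi i = E (- of_int i * l / 2) k + 1" for i
    proof -
      have "inverse (exp (l / 2 ^ (k + 1))) powi i = exp (- (l / 2 ^ (k + 1))) powi i"
        by (simp only: exp_minus)
      also have "\<dots> = exp (of_int i * (- (l / 2 ^ (k + 1))))"
        by (rule exp_power_int)
      also have "of_int i * (- (l / 2 ^ (k + 1))) = (- of_int i * l / 2) / 2 ^ k"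
        by simp
      finally show ?thesis
        by (simp only: E_def diff_add_cancel)
    qed
    have "mask_symbol (A k) (inverse (exp (l / 2 ^ (k + 1)))) = 2 * exp (- of_real p * (l / 2 ^ (k + 1)))"
      using repr by (simp only: symbols_reproduce_exp_def)
    also have "- of_real p * (l / 2 ^ (k + 1)) = (- of_real p * l / 2) / 2 ^ k"
      by simp
    also have "exp \<dots> = E (- of_real p * l / 2) k + 1"
      by (simp only: E_def diff_add_cancel)
    finally have "2 * (E (- of_real p * l / 2) k + 1) =
        (\<Sum>i\<in>{- int M..int M}. of_real (A k i) * (E (- of_int i * l / 2) k + 1))"
      by (simp only: mask_symbol_eq_sum[OF within] powi)
    moreover have "mask_symbol (A k) 1 = (\<Sum>i\<in>{- int M..int M}. of_real (A k i))"
      by (simp add: mask_symbol_eq_sum[OF within])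
    ultimately have "2 * (E (- of_real p * l / 2) k + 1) =
        (\<Sum>i\<in>{- int M..int M}. of_real (A k i) * E (- of_int i * l / 2) k) + mask_symbol (A k) 1"
      by (simp only: distrib_left sum.distrib mult_1_right)
    moreover have "s - 2 = 2 * e - t" if "2 * (e + 1) = t + s" for s e t :: complex
      using that by (simp add: algebra_simps)
    ultimately show ?thesis
      by blast
  qed
  have "(\<lambda>k. complex_of_real (A k i)) \<in> O(\<lambda>_. 1)" for i
    using bound by (intro bigoI[where c = C]) auto
  then have "(\<lambda>k. of_real (A k i) * E (- of_int i * l / 2) k) \<in> O(\<lambda>k. 1 / 2 ^ k)" for i
    using landau_o.big.mult[OF _ E, of "\<lambda>k. of_real (A k i)" "\<lambda>_. 1"] by (simp only: mult_1_left)
  then have "(\<lambda>k. \<Sum>i\<in>{- int M..int M}. of_real (A k i) * E (- of_int i * l / 2) k) \<in> O(\<lambda>k. 1 / 2 ^ k)"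
    by (rule big_sum_in_bigo)
  moreover have "(\<lambda>k. 2 * E (- of_real p * l / 2) k) \<in> O(\<lambda>k. 1 / 2 ^ k)"
    using E by (subst landau_o.big.cmult_in_iff) simp_all
  ultimately have "(\<lambda>k. mask_symbol (A k) 1 - 2) \<in> O(\<lambda>k. 1 / 2 ^ k)"
    unfolding eq by (rule sum_in_bigo(2)[rotated])
  then obtain c where "\<forall>\<^sub>F k in sequentially.
      norm (mask_symbol (A k) 1 - 2) \<le> c * norm (1 / 2 ^ k :: complex)"
    by (auto elim: landau_o.bigE)
  then have "\<forall>\<^sub>F k in sequentially. norm (norm (mask_symbol (A k) 1 - 2)) \<le> c * (1 / 2) ^ k"
    by (simp add: norm_divide norm_power power_one_over)
  then show ?thesis
    by (rule summable_comparison_test_ev) (intro summable_mult summable_geometric, simp)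
qed

section \<open>Decay of the symbols near minus one\<close>

text \<open>This transfers a bound on the symbol to its cofactor \<open>b\<close>. The zeros of \<open>P\<close> inside the disc
  rule out a direct division there, but the maximum modulus principle needs the quotient only on
  the boundary.\<close>
lemma norm_le_of_norm_mult_le_on_sphere:
  fixes b P :: "complex \<Rightarrow> complex"
  assumes "b holomorphic_on cball c \<rho>" and "0 < \<rho>" and "0 < m"
    and "\<And>z. z \<in> sphere c \<rho> \<Longrightarrow> m \<le> norm (P z)"
    and "\<And>z. z \<in> sphere c \<rho> \<Longrightarrow> norm (b z * P z) \<le> K"
    and "w \<in> cball c \<rho>"
  shows "norm (b w) \<le> K / m"
proof (rule maximum_modulus_frontier[where S = "cball c \<rho>" and f = b])
  show "b holomorphic_on interior (cball c \<rho>)"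
    using assms(1) holomorphic_on_subset interior_subset by blast
  show "continuous_on (closure (cball c \<rho>)) b"
    using assms(1) by (simp add: holomorphic_on_imp_continuous_on)
  fix z assume "z \<in> frontier (cball c \<rho>)"
  then have "z \<in> sphere c \<rho>"
    using assms(2) by (simp add: frontier_cball)
  then have m: "m \<le> norm (P z)" and K: "norm (b z) * norm (P z) \<le> K"
    using assms(4,5) by (auto simp: norm_mult)
  have "norm (b z) * m \<le> norm (b z) * norm (P z)"
    using m by (rule mult_left_mono) simp
  with K assms(3) show "norm (b z) \<le> K / m"
    by (simp add: pos_le_divide_eq)
qed (use assms(6) in auto)

text \<open>Each factor \<open>1 + r z\<close> is a perturbation of \<open>z + 1\<close> by \<open>(r - 1) z\<close>, where \<open>\<bar>z\<bar> \<le> 3/2\<close>. The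
  upper bound serves close to \<open>-1\<close>, the lower bound on the circle of radius \<open>1/2\<close>.\<close>
lemma norm_prod_linear_factors_bounds:
  fixes r :: "nat \<Rightarrow> complex"
  assumes "\<And>n. n < \<eta> \<Longrightarrow> norm (r n - 1) \<le> \<epsilon>" and "z \<in> cball (- 1) (1 / 2)"
  shows "norm (\<Prod>n<\<eta>. (1 + r n * z) ^ mu n) \<le> (norm (z + 1) + 3 / 2 * \<epsilon>) ^ (\<Sum>n<\<eta>. mu n)"
    and "3 / 2 * \<epsilon> \<le> norm (z + 1) \<Longrightarrow>
      (norm (z + 1) - 3 / 2 * \<epsilon>) ^ (\<Sum>n<\<eta>. mu n) \<le> norm (\<Prod>n<\<eta>. (1 + r n * z) ^ mu n)"
proof -
  have z: "norm z \<le> 3 / 2"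
  proof -
    have "norm z \<le> norm (z + 1) + norm (1 :: complex)"
      by norm
    moreover have "norm (z + 1) \<le> 1 / 2"
      using assms(2) by (simp add: dist_norm norm_minus_commute)
    ultimately show ?thesis
      by simp
  qed
  have diff: "norm ((r n - 1) * z) \<le> 3 / 2 * \<epsilon>" if "n < \<eta>" for n
    using mult_mono[OF assms(1)[OF that] z] order_trans[OF norm_ge_zero assms(1)[OF that]]
    by (simp add: norm_mult mult.commute)
  have factor: "1 + r n * z = (z + 1) + (r n - 1) * z" for n
    by (simp add: algebra_simps)
  have upper: "norm (1 + r n * z) \<le> norm (z + 1) + 3 / 2 * \<epsilon>"
    and lower: "norm (z + 1) - 3 / 2 * \<epsilon> \<le> norm (1 + r n * z)" if "n < \<eta>" for n
    using diff[OF that] norm_triangle_ineq[of "z + 1" "(r n - 1) * z"]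
      norm_diff_ineq[of "z + 1" "(r n - 1) * z"]
    unfolding factor by linarith+
  show "norm (\<Prod>n<\<eta>. (1 + r n * z) ^ mu n) \<le> (norm (z + 1) + 3 / 2 * \<epsilon>) ^ (\<Sum>n<\<eta>. mu n)"
    unfolding power_sum prod_norm[symmetric] norm_power
    by (intro prod_mono conjI power_mono upper) auto
  show "(norm (z + 1) - 3 / 2 * \<epsilon>) ^ (\<Sum>n<\<eta>. mu n) \<le> norm (\<Prod>n<\<eta>. (1 + r n * z) ^ mu n)"
    if "3 / 2 * \<epsilon> \<le> norm (z + 1)"
    unfolding power_sum prod_norm[symmetric] norm_power
    using that by (intro prod_mono conjI power_mono lower) auto
qed

text \<open>For \<open>\<epsilon> \<le> 1/6\<close> every factor has modulus at least \<open>1/2 - 3/2 \<cdot> 1/6 = 1/4\<close> on the circle of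
  radius \<open>1/2\<close>; so the cofactor is at most \<open>4\<^sup>N K\<close> on the disc, and the remaining power is the
  size of the product of the factors at \<open>z\<close>.\<close>
lemma norm_factored_symbol_le:
  fixes r :: "nat \<Rightarrow> complex" and b :: "int \<Rightarrow> complex"
  assumes factored: "\<And>z. z \<noteq> 0 \<Longrightarrow> f z = laurent_eval b z * (\<Prod>n<\<eta>. (1 + r n * z) ^ mu n)"
    and bound: "\<And>z. z \<in> cball (- 1) (1 / 2) \<Longrightarrow> norm (f z) \<le> K"
    and r: "\<And>n. n < \<eta> \<Longrightarrow> norm (r n - 1) \<le> \<epsilon>" and \<epsilon>: "\<epsilon> \<le> 1 / 6"
    and z: "z \<in> cball (- 1) (1 / 2)"
  shows "norm (f z) \<le> K * 4 ^ (\<Sum>n<\<eta>. mu n) * (norm (z + 1) + 3 / 2 * \<epsilon>) ^ (\<Sum>n<\<eta>. mu n)"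
proof -
  define N where "N = (\<Sum>n<\<eta>. mu n)"
  define P where "P z = (\<Prod>n<\<eta>. (1 + r n * z) ^ mu n)" for z
  have zero: "0 \<notin> cball (- 1 :: complex) (1 / 2)"
    by simp
  have fP: "f z = laurent_eval b z * P z" if "z \<in> cball (- 1) (1 / 2)" for z
    using factored that zero unfolding P_def by metis
  have "norm (laurent_eval b z) \<le> K / (1 / 4) ^ N"
  proof (rule norm_le_of_norm_mult_le_on_sphere[where b = "laurent_eval b" and P = P
        and c = "- 1" and \<rho> = "1 / 2"])
    show "laurent_eval b holomorphic_on cball (- 1) (1 / 2)"
      using zero by (rule laurent_eval_holomorphic_on)
    fix w :: complex assume w: "w \<in> sphere (- 1) (1 / 2)"
    then have w': "w \<in> cball (- 1) (1 / 2)" and w1: "norm (w + 1) = 1 / 2"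
      by (auto simp: dist_norm norm_minus_commute)
    show "norm (laurent_eval b w * P w) \<le> K"
      using bound[OF w'] fP[OF w'] by simp
    have "(1 / 4) ^ N \<le> (norm (w + 1) - 3 / 2 * \<epsilon>) ^ N"
      using \<epsilon> w1 by (intro power_mono) auto
    also have "\<dots> \<le> norm (P w)"
      unfolding N_def P_def
      by (rule norm_prod_linear_factors_bounds(2)[OF r w']) (use \<epsilon> w1 in auto)
    finally show "(1 / 4) ^ N \<le> norm (P w)" .
  qed (use z in auto)
  moreover have "norm (P z) \<le> (norm (z + 1) + 3 / 2 * \<epsilon>) ^ N"
    unfolding N_def P_def by (rule norm_prod_linear_factors_bounds(1)[OF r z])
  ultimately have "norm (f z) \<le> K / (1 / 4) ^ N * (norm (z + 1) + 3 / 2 * \<epsilon>) ^ N"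
    unfolding fP[OF z] norm_mult
    by (rule mult_mono'[OF _ _ norm_ge_zero norm_ge_zero])
  then show ?thesis
    by (simp add: N_def power_one_over)
qed

section \<open>Summability of the defects\<close>

text \<open>Cauchy's inequality on the circle of radius \<open>2\<^sup>-\<^sup>k\<close> has the factor \<open>2\<^sup>k\<^sup>\<beta>\<close>, which the weight
  \<open>2\<^sup>-\<^sup>k\<^sup>\<beta>\<close> in the defect cancels. A level \<open>k > 0\<close> keeps the circle away from the pole at \<open>0\<close>.\<close>
lemma sum_rule_defect_le:
  assumes "0 < N" and "0 < k" and "0 \<le> B"
    and "\<And>z. norm (z + 1) = 1 / 2 ^ k \<Longrightarrow> norm (mask_symbol (A k) z) \<le> B"
  shows "sum_rule_defect N A k \<le> fact N * B"
proof -
  have "(1 / 2 :: real) ^ k \<le> 1 / 2"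
    using assms(2) power_decreasing[of 1 k "1 / 2 :: real"] by simp
  then have hol: "mask_symbol (A k) holomorphic_on cball (- 1) (1 / 2 ^ k)"
    by (intro mask_symbol_holomorphic_on) (simp add: power_one_over)
  have "1 / 2 ^ (k * \<beta>) * norm ((deriv ^^ \<beta>) (mask_symbol (A k)) (- 1)) \<le> fact N * B"
    if "\<beta> < N" for \<beta>
  proof -
    have "norm ((deriv ^^ \<beta>) (mask_symbol (A k)) (- 1)) \<le> fact \<beta> * B / (1 / 2 ^ k) ^ \<beta>"
    proof (rule Cauchy_inequality)
      show "mask_symbol (A k) holomorphic_on ball (- 1) (1 / 2 ^ k)"
        using hol ball_subset_cball holomorphic_on_subset by blast
      show "continuous_on (cball (- 1) (1 / 2 ^ k)) (mask_symbol (A k))"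
        using hol by (rule holomorphic_on_imp_continuous_on)
      show "norm (mask_symbol (A k) z) \<le> B" if "norm (- 1 - z) = 1 / 2 ^ k" for z
        using assms(4)[of z] that norm_minus_cancel[of "- 1 - z"] by (simp add: add.commute)
    qed simp
    then have "1 / 2 ^ (k * \<beta>) * norm ((deriv ^^ \<beta>) (mask_symbol (A k)) (- 1)) \<le> fact \<beta> * B"
      by (simp add: field_simps flip: power_mult)
    also have "\<dots> \<le> fact N * B"
      using that assms(3) by (intro mult_right_mono fact_mono) auto
    finally show ?thesis .
  qed
  then show ?thesis
    unfolding sum_rule_defect_def using assms(1) by (subst Max_le_iff) auto
qed

lemma sum_rule_defect_nonneg:
  assumes "0 < N"
  shows "0 \<le> sum_rule_defect N A k"
proof -
  have "0 \<le> 1 / 2 ^ (k * 0) * norm ((deriv ^^ 0) (mask_symbol (A k)) (- 1))"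
    by simp
  also have "\<dots> \<le> sum_rule_defect N A k"
    unfolding sum_rule_defect_def using assms by (intro Max_ge imageI) auto
  finally show ?thesis .
qed

text \<open>The zeros of the symbol approach \<open>-1\<close> at rate \<open>2\<^sup>-\<^sup>k\<close>, the radius at which the derivatives
  are estimated, so all \<open>N\<close> factors contribute the same power of \<open>2\<^sup>-\<^sup>k\<close>.\<close>
lemma summable_sum_rule_defect:
  fixes \<eta> :: nat
  assumes within: "\<And>k. mask_within M (A k)"
    and bound: "\<And>k i. \<bar>A k i\<bar> \<le> C" and "0 \<le> C"
    and N: "(\<Sum>n<\<eta>. mu n) = N" "0 < N"
    and factor: "\<And>k. \<exists>b. \<forall>z. z \<noteq> 0 \<longrightarrow>
      mask_symbol (A k) z =
        laurent_eval b z * (\<Prod>n<\<eta>. (1 + exp (lam n / 2 ^ (k + 1)) * z) ^ mu n)"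
  shows "summable (\<lambda>k. 2 ^ (k * (N - 1)) * sum_rule_defect N A k)"
proof -
  define L where "L = (\<Sum>n<\<eta>. norm (lam n))"
  have L: "norm (lam n) \<le> L" if "n < \<eta>" for n
    unfolding L_def using that by (intro member_le_sum) auto
  have "0 \<le> L"
    by (simp add: L_def sum_nonneg)
  define K where "K = real (2 * M + 1) * (C * 2 ^ M)"
  have "0 \<le> K"
    using \<open>0 \<le> C\<close> by (simp add: K_def)
  define D where "D = K * 4 ^ N * (1 + 3 * L) ^ N"
  have "0 \<le> D"
    using \<open>0 \<le> K\<close> \<open>0 \<le> L\<close> by (simp add: D_def)
  have "\<forall>\<^sub>F k in sequentially. norm (2 ^ (k * (N - 1)) * sum_rule_defect N A k)
      \<le> fact N * D * (1 / 2) ^ k"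
    \<comment> \<open>Here \<open>12 L \<le> 2\<^sup>k\<close> makes the perturbation \<open>\<epsilon> = 2 L / 2\<^sup>k\<close> at most \<open>1/6\<close>, and \<open>2 \<le> 2\<^sup>k\<close> puts
      the circle of radius \<open>2\<^sup>-\<^sup>k\<close> inside the disc of radius \<open>1/2\<close>.\<close>
    using eventually_le_power2[of "12 * L + 2"]
  proof eventually_elim
    case (elim k)
    define \<epsilon> where "\<epsilon> = 2 * L / 2 ^ k"
    have k: "12 * L \<le> 2 ^ k" "1 / 2 ^ k \<le> (1 / 2 :: real)" "0 < k"
      using elim \<open>0 \<le> L\<close> by (auto simp: field_simps intro: Nat.gr0I)
    have \<epsilon>: "\<epsilon> \<le> 1 / 6"
      using k by (simp add: \<epsilon>_def field_simps)
    have r: "norm (exp (lam n / 2 ^ (k + 1)) - 1) \<le> \<epsilon>" if "n < \<eta>" for n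
    proof -
      have le: "norm (lam n / 2 ^ (k + 1)) \<le> L / 2 ^ (k + 1)"
        using L[OF that] by (simp add: norm_divide norm_power divide_right_mono)
      also have "\<dots> \<le> 1"
        using k \<open>0 \<le> L\<close> by (simp add: field_simps)
      finally have "norm (exp (lam n / 2 ^ (k + 1)) - 1) \<le> 3 * norm (lam n / 2 ^ (k + 1))"
        by (rule norm_exp_minus_one_le)
      also have "\<dots> \<le> 3 * (L / 2 ^ (k + 1))"
        using le by simp
      also have "\<dots> \<le> \<epsilon>"
        using \<open>0 \<le> L\<close> by (simp add: \<epsilon>_def field_simps)
      finally show ?thesis .
    qed
    obtain b where b: "\<And>z. z \<noteq> 0 \<Longrightarrow> mask_symbol (A k) z =
        laurent_eval b z * (\<Prod>n<\<eta>. (1 + exp (lam n / 2 ^ (k + 1)) * z) ^ mu n)"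
      using factor by blast
    have "sum_rule_defect N A k \<le> fact N * (D / 2 ^ (k * N))"
    proof (rule sum_rule_defect_le)
      fix z :: complex assume z: "norm (z + 1) = 1 / 2 ^ k"
      then have z': "z \<in> cball (- 1) (1 / 2)"
        using k by (simp add: dist_norm norm_minus_commute)
      have "norm (mask_symbol (A k) z) \<le> K * 4 ^ N * (norm (z + 1) + 3 / 2 * \<epsilon>) ^ N"
        using norm_factored_symbol_le[OF b _ r \<epsilon> z', of K] norm_mask_symbol_le[OF within bound]
        unfolding N K_def by simp
      also have "norm (z + 1) + 3 / 2 * \<epsilon> = (1 + 3 * L) / 2 ^ k"
        unfolding z \<epsilon>_def by (simp add: field_simps)
      finally show "norm (mask_symbol (A k) z) \<le> D / 2 ^ (k * N)"
        by (simp add: D_def power_divide power_mult)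
    qed (use N k \<open>0 \<le> D\<close> in auto)
    then have "2 ^ (k * (N - 1)) * sum_rule_defect N A k
        \<le> 2 ^ (k * (N - 1)) * (fact N * (D / 2 ^ (k * N)))"
      by (rule mult_left_mono) simp
    also have "(2 :: real) ^ (k * N) = 2 ^ (k * (N - 1)) * 2 ^ k"
      using N(2) by (cases N) (simp_all add: power_add)
    finally show ?case
      using sum_rule_defect_nonneg[OF N(2), of A k] by (simp add: power_one_over field_simps)
  qed
  then show ?thesis
    by (rule summable_comparison_test_ev) (intro summable_mult summable_geometric, simp)
qed

theorem corollary14:
  fixes A :: "nat \<Rightarrow> int \<Rightarrow> real" and a :: "int \<Rightarrow> real"
    and M N \<eta> :: nat and lam :: "nat \<Rightarrow> complex" and mu :: "nat \<Rightarrow> nat"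
    and \<phi> :: "nat \<Rightarrow> real \<Rightarrow> complex" and p :: real
  assumes "\<And>k. mask_within M (A k)" and "mask_within M a"
    and "p \<in> {0, - 1 / 2}"
    and "(\<Sum>n<\<eta>. mu n) = N"
    and "\<phi> ` {..<N} = exp_monomials \<eta> lam mu" and "lin_indep_funs N \<phi>"
    and "generating p \<eta> lam mu A"
    and "reproduces_some p \<eta> lam mu A"
    and "\<forall>\<^sub>F x in nhds 0. invertible_mat (wronskian_mat N \<phi> x)"
    and "convergent_scheme (\<lambda>_. a)"
    and "asymptotically_similar A a"
  shows "approximate_sum_rules N A"
proof -
  obtain C where C: "\<And>k i. \<bar>A k i\<bar> \<le> C" "0 \<le> C"
    using asymptotically_similar_bounded[OF assms(1,2,11)] by blast
  obtain n r where n: "n < \<eta>" "r < mu n" and repr: "symbols_reproduce_exp p (lam n) A"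
    using assms(8) unfolding reproduces_some_def by blast
  \<comment> \<open>The reproduced function has a positive multiplicity, which makes the maximum in the defect
    one over a non-empty set.\<close>
  have "mu n \<le> N"
    unfolding assms(4)[symmetric] using n by (intro member_le_sum) auto
  with n have "0 < N"
    by simp
  have factor: "\<exists>b. \<forall>z. z \<noteq> 0 \<longrightarrow> mask_symbol (A k) z =
      laurent_eval b z * (\<Prod>n<\<eta>. (1 + exp (lam n / 2 ^ (k + 1)) * z) ^ mu n)" for k
    using assms(7) unfolding generating_def by blast
  show ?thesis
    unfolding approximate_sum_rules_def
    using summable_symbol_at_one[OF assms(1) C(1) repr]
      summable_sum_rule_defect[OF assms(1) C assms(4) \<open>0 < N\<close> factor] by blast
qed

end
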